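(* Let $k\ge 10$ and let $p$ be a prime. (i) If $p$ is odd and $p$ divides $k$, then there is a finite group $H$ with an elementary abelian $p$-subgroup $1\ne M\trianglelefteq H$ such that $H/M\cong A_k$, the extension $1\to M\to H\to A_k\to 1$ is nonsplit, and $H$ has a faithful permutation representation of degree $\frac12 pk(k-1)$. (ii) There is a finite group $H$ with an elementary abelian $2$-subgroup $1\ne M\trianglelefteq H$ such that $H/M\cong A_k$, the extension $1\to M\to H\to A_k\to 1$ is nonsplit, and $H$ has a faithful transitive permutation representation of degree $2k(k-1)$.
   Context: An extension $1\to M\to H\to A_k\to 1$ is nonsplit if $M$ has no complement in $H$. *)

theory Defs
  imports "HOL-Algebra.Algebra"
begin

definition elem_abelian_p_subgroup :: "nat \<Rightarrow> 'a set \<Rightarrow> ('a, 'b) monoid_scheme \<Rightarrow> bool" where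
  "elem_abelian_p_subgroup p M H \<longleftrightarrow>
     subgroup M H \<and>
     (\<forall>x\<in>M. \<forall>y\<in>M. x \<otimes>\<^bsub>H\<^esub> y = y \<otimes>\<^bsub>H\<^esub> x) \<and>
     (\<forall>x\<in>M. x [^]\<^bsub>H\<^esub> p = \<one>\<^bsub>H\<^esub>)"

definition complement :: "'a set \<Rightarrow> 'a set \<Rightarrow> ('a, 'b) monoid_scheme \<Rightarrow> bool" where
  "complement K M H \<longleftrightarrow>
     subgroup K H \<and> K \<inter> M = {\<one>\<^bsub>H\<^esub>} \<and> K <#>\<^bsub>H\<^esub> M = carrier H"

definition nonsplit :: "'a set \<Rightarrow> ('a, 'b) monoid_scheme \<Rightarrow> bool" where
  "nonsplit M H \<longleftrightarrow> \<not> (\<exists>K. complement K M H)"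

definition faithful_perm_rep :: "('a, 'b) monoid_scheme \<Rightarrow> nat \<Rightarrow> ('a \<Rightarrow> nat \<Rightarrow> nat) \<Rightarrow> bool" where
  "faithful_perm_rep H d \<phi> \<longleftrightarrow> \<phi> \<in> hom H (sym_group d) \<and> inj_on \<phi> (carrier H)"

definition transitive_perm_rep :: "('a, 'b) monoid_scheme \<Rightarrow> nat \<Rightarrow> ('a \<Rightarrow> nat \<Rightarrow> nat) \<Rightarrow> bool" where
  "transitive_perm_rep H d \<phi> \<longleftrightarrow>
     (\<forall>i\<in>{1..d}. \<forall>j\<in>{1..d}. \<exists>h\<in>carrier H. \<phi> h i = j)"

end

theory Submission
  imports Defs "HOL-Number_Theory.Cong"
begin

text \<open>
  Let \<open>V\<close> be the \<open>A\<^sub>k\<close>-module of functions on ordered pairs of distinct points with values in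
  \<open>\<int>/p\<close>. The group \<open>V \<rtimes> A\<^sub>k\<close> acts on \<open>p k (k - 1)\<close> points, namely pairs decorated with an
  element of \<open>\<int>/p\<close>. For a quotient \<open>\<partial> : V \<rightarrow> W\<close> and a cocycle \<open>c : A\<^sub>k \<rightarrow> W\<close> the elements
  \<open>(f, g)\<close> with \<open>\<partial>f = c(g)\<close> form an extension of \<open>A\<^sub>k\<close> by \<open>M = ker \<partial>\<close>. It is nonsplit as soon
  as some \<open>a \<in> A\<^sub>k\<close> with \<open>a\<^sup>n = 1\<close> has no lift \<open>h\<close> with \<open>h\<^sup>n = 1\<close>.

  For \<open>p = 2\<close> let \<open>\<partial>f(i,j) = f(i,j) + f(j,i)\<close>, and let \<open>c(g)\<close> record which pairs have their
  order reversed by \<open>g\<close>. Every lift of \<open>(1 2)(3 4)\<close> then acts on the fibres over \<open>(1,2)\<close>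
  and \<open>(2,1)\<close> with order 4.

  For odd \<open>p\<close> dividing \<open>k\<close> take antisymmetric \<open>f\<close>, the divergence \<open>\<partial>f(i) = \<Sum>\<^sub>j f(i,j)\<close>, and the
  coboundary \<open>c(g)\<close> of the unit vector at 1, which is a cocycle with values in the vectors of
  sum zero, although the unit vector itself is not one. Identifying \<open>(i,j,e)\<close> with
  \<open>(j,i,-e)\<close> halves the number of points. Let \<open>a\<close> be a product of \<open>k/p\<close> disjoint \<open>p\<close>-cycles
  with \<open>a(i) \<equiv> i + 1\<close> modulo \<open>p\<close>. If \<open>(f, a)\<close> had order \<open>p\<close>, then \<open>f\<close> would have sum zero on
  every orbit of \<open>a\<close> on pairs. As \<open>i - j\<close> modulo \<open>p\<close> is constant on orbits, this gives
  \<open>0 \<equiv> \<Sum> (i - j) f(i,j) = 2 \<Sum> i f(i,j) \<equiv> -2\<close>.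
\<close>

section \<open>Nonsplit extensions and permutation actions\<close>

text \<open>A complement K of the kernel contains a lift of \<open>a\<close>. Its n-th power lies in
  K and, since \<open>a\<close> has n-th power 1, in the kernel; so it is trivial, which the last
  hypothesis forbids.\<close>

lemma nonsplitI:
  fixes G (structure) and n :: nat
  assumes "group_hom G Q \<pi>"
    and a: "a \<in> carrier Q" "a [^]\<^bsub>Q\<^esub> n = \<one>\<^bsub>Q\<^esub>"
    and surj: "\<pi> ` carrier G = carrier Q"
    and no_lift: "\<And>h. h \<in> carrier G \<Longrightarrow> \<pi> h = a \<Longrightarrow> h [^]\<^bsub>G\<^esub> n \<noteq> \<one>\<^bsub>G\<^esub>"
  shows "nonsplit (kernel G Q \<pi>) G"
  unfolding nonsplit_def
proof
  interpret group_hom G Q \<pi> by fact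
  assume "\<exists>K. complement K (kernel G Q \<pi>) G"
  then obtain K where K: "subgroup K G" and triv: "K \<inter> kernel G Q \<pi> = {\<one>}"
    and full: "K <#> kernel G Q \<pi> = carrier G"
    by (auto simp: complement_def)
  obtain h where h: "h \<in> carrier G" "\<pi> h = a"
    using a(1) surj by (metis imageE)
  then obtain c m where c: "c \<in> K" "m \<in> kernel G Q \<pi>" "h = c \<otimes> m"
    using full unfolding set_mult_def by blast
  have cG: "c \<in> carrier G" using K c(1) by (rule subgroup.mem_carrier)
  have "\<pi> c = a"
    using c h cG by (auto simp: kernel_def)
  moreover from this have "\<pi> (c [^] n) = \<one>\<^bsub>Q\<^esub>"
    using a cG by (simp add: hom_nat_pow)
  moreover have "c [^] n \<in> K"
    using G.subgroup_int_pow_closed[OF K c(1), of "int n"] by (simp add: int_pow_int)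
  ultimately have "c [^] n = \<one>"
    using triv cG by (auto simp: kernel_def)
  with no_lift cG \<open>\<pi> c = a\<close> show False by blast
qed

text \<open>With this, nonsplitness alone forces the kernel to be nontrivial.\<close>

lemma complement_trivial:
  assumes "group G" shows "complement (carrier G) {\<one>\<^bsub>G\<^esub>} G"
proof -
  interpret group G by fact
  show ?thesis
    unfolding complement_def set_mult_def using subgroup_self by force
qed

text \<open>The action on \<Omega> is carried over to {1..d} along an enumeration. Transitivity is
  kept as an implication, so that one statement serves both characteristics.\<close>

lemma action_imp_perm_rep:
  fixes G (structure)
  assumes "group G" and fin: "finite \<Omega>" and card: "card \<Omega> = d"
    and act: "\<And>h x. h \<in> carrier G \<Longrightarrow> x \<in> \<Omega> \<Longrightarrow> \<alpha> h x \<in> \<Omega>"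
    and act1: "\<And>x. x \<in> \<Omega> \<Longrightarrow> \<alpha> \<one>\<^bsub>G\<^esub> x = x"
    and actm: "\<And>h h' x. h \<in> carrier G \<Longrightarrow> h' \<in> carrier G \<Longrightarrow> x \<in> \<Omega> \<Longrightarrow> \<alpha> (h \<otimes>\<^bsub>G\<^esub> h') x = \<alpha> h (\<alpha> h' x)"
    and faithful: "\<And>h. h \<in> carrier G \<Longrightarrow> (\<And>x. x \<in> \<Omega> \<Longrightarrow> \<alpha> h x = x) \<Longrightarrow> h = \<one>\<^bsub>G\<^esub>"
  shows "\<exists>\<phi>. faithful_perm_rep G d \<phi> \<and>
    ((\<forall>x\<in>\<Omega>. \<forall>y\<in>\<Omega>. \<exists>h\<in>carrier G. \<alpha> h x = y) \<longrightarrow> transitive_perm_rep G d \<phi>)"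
proof -
  interpret group G by fact
  define I where "I = {1..d}"
  obtain \<beta> where \<beta>: "bij_betw \<beta> I \<Omega>"
    using ex_bij_betw_nat_finite_1[OF fin] card unfolding I_def by blast
  define \<beta>' where "\<beta>' = the_inv_into I \<beta>"
  have \<beta>': "bij_betw \<beta>' \<Omega> I"
    unfolding \<beta>'_def by (rule bij_betw_the_inv_into[OF \<beta>])
  have [simp]: "\<beta> (\<beta>' x) = x" if "x \<in> \<Omega>" for x
    unfolding \<beta>'_def using that \<beta> f_the_inv_into_f_bij_betw by fastforce
  have [simp]: "\<beta>' (\<beta> i) = i" if "i \<in> I" for i
    unfolding \<beta>'_def using that \<beta> by (simp add: bij_betw_def the_inv_into_f_f)
  have b[simp]: "\<beta> i \<in> \<Omega>" if "i \<in> I" for i using \<beta> that by (auto simp: bij_betw_def)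
  have b'[simp]: "\<beta>' x \<in> I" if "x \<in> \<Omega>" for x using \<beta>' that unfolding bij_betw_def by blast
  \<comment> \<open>The identity outside {1..d} is what membership in \<open>sym_group d\<close>
    demands.\<close>
  define \<phi> where "\<phi> h = (\<lambda>i. if i \<in> I then \<beta>' (\<alpha> h (\<beta> i)) else i)" for h
  have cl: "\<phi> h i \<in> I" if "h \<in> carrier G" "i \<in> I" for h i
    using that act unfolding \<phi>_def by simp
  have mul: "\<phi> (h \<otimes> h') = \<phi> h \<circ> \<phi> h'" if "h \<in> carrier G" "h' \<in> carrier G" for h h'
  proof
    fix i show "\<phi> (h \<otimes> h') i = (\<phi> h \<circ> \<phi> h') i"
      using that cl[of h' i] by (cases "i \<in> I") (auto simp: \<phi>_def actm act)
  qed
  have one: "\<phi> \<one> = id"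
    by (auto simp: \<phi>_def act1)
  have perm: "\<phi> h permutes I" if h: "h \<in> carrier G" for h
  proof -
    have "\<phi> h \<circ> \<phi> (inv h) = id" "\<phi> (inv h) \<circ> \<phi> h = id"
      using h mul[of h "inv h"] mul[of "inv h" h] one by auto
    then have "bij (\<phi> h)" using o_bij by blast
    then show ?thesis
      by (auto simp: permutes_def \<phi>_def bij_iff)
  qed
  have hom: "\<phi> \<in> hom G (sym_group d)"
    using perm mul by (auto simp: hom_def sym_group_def I_def)
  then interpret \<phi>: group_hom G "sym_group d" \<phi>
    by (simp add: group_hom_def group_hom_axioms_def sym_group_is_group)
  have "inj_on \<phi> (carrier G)"
  proof (subst \<phi>.inj_iff_trivial_ker, rule equalityI; rule subsetI)
    fix h assume "h \<in> kernel G (sym_group d) \<phi>"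
    then have h: "h \<in> carrier G" "\<phi> h = id" by (auto simp: kernel_def sym_group_def)
    have "\<alpha> h x = x" if "x \<in> \<Omega>" for x
    proof -
      have "\<beta>' (\<alpha> h x) = \<beta>' x"
        using fun_cong[OF h(2), of "\<beta>' x"] that b'[OF that] by (simp add: \<phi>_def)
      then have "\<beta> (\<beta>' (\<alpha> h x)) = \<beta> (\<beta>' x)" by simp
      then show ?thesis using that h act by simp
    qed
    then show "h \<in> {\<one>}" using faithful h by blast
  qed (auto simp: kernel_def)
  moreover have "transitive_perm_rep G d \<phi>"
    if tr: "\<forall>x\<in>\<Omega>. \<forall>y\<in>\<Omega>. \<exists>h\<in>carrier G. \<alpha> h x = y"
    unfolding transitive_perm_rep_def I_def[symmetric]
  proof (intro ballI)
    fix i j assume ij: "i \<in> I" "j \<in> I"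
    then obtain h where "h \<in> carrier G" "\<alpha> h (\<beta> i) = \<beta> j" using tr b by metis
    then show "\<exists>h\<in>carrier G. \<phi> h i = j" using ij by (auto simp: \<phi>_def intro!: bexI[of _ h])
  qed
  ultimately show ?thesis using hom unfolding faithful_perm_rep_def by blast
qed

text \<open>The goal asks for a group on natural numbers, while the construction lives on pairs of
  functions; the structure is copied along an enumeration of the carrier.\<close>

lemma finite_group_iso_nat:
  fixes G (structure)
  assumes "group G" and "finite (carrier G)"
  shows "\<exists>(H :: nat monoid) e. group H \<and> e \<in> iso H G"
proof -
  interpret group G by fact
  obtain e where e: "bij_betw e (carrier G) {0..<card (carrier G)}"
    using ex_bij_betw_finite_nat[OF assms(2)] by blast
  define e' where "e' = the_inv_into (carrier G) e"
  define H :: "nat monoid" where "H = \<lparr>carrier = e ` carrier G,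
    monoid.mult = \<lambda>a b. e (e' a \<otimes> e' b), one = e \<one>\<rparr>"
  have e'e: "e' (e x) = x" if "x \<in> carrier G" for x
    using e that by (simp add: e'_def bij_betw_def the_inv_into_f_f)
  have grp: "group H"
  proof (rule groupI)
    fix x assume "x \<in> carrier H"
    then obtain y where y: "y \<in> carrier G" "x = e y" by (auto simp: H_def)
    then show "\<exists>y\<in>carrier H. y \<otimes>\<^bsub>H\<^esub> x = \<one>\<^bsub>H\<^esub>"
      by (auto simp: H_def e'e intro!: bexI[of _ "inv y"])
  qed (auto simp: H_def e'e m_assoc)
  have "e \<in> hom G H"
    by (auto simp: hom_def H_def e'e)
  moreover have "bij_betw e (carrier G) (carrier H)"
    using e by (simp add: H_def bij_betw_def)
  ultimately have "e \<in> iso G H" by (simp add: iso_def)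
  then show ?thesis using grp group.iso_set_sym[OF assms(1)] by blast
qed

text \<open>Reduces both halves of the theorem to data on a concrete G: a projection with elementary
  abelian kernel, an element without a lift of order dividing n, and a faithful action.\<close>

lemma realize_extension:
  fixes G (structure) and n p :: nat
  assumes "group_hom G Q \<pi>" and finG: "finite (carrier G)"
    and surj: "\<pi> ` carrier G = carrier Q"
    and comm: "\<And>x y. x \<in> kernel G Q \<pi> \<Longrightarrow> y \<in> kernel G Q \<pi> \<Longrightarrow> x \<otimes>\<^bsub>G\<^esub> y = y \<otimes>\<^bsub>G\<^esub> x"
    and expo: "\<And>x. x \<in> kernel G Q \<pi> \<Longrightarrow> x [^]\<^bsub>G\<^esub> p = \<one>\<^bsub>G\<^esub>"
    and a: "a \<in> carrier Q" "a [^]\<^bsub>Q\<^esub> n = \<one>\<^bsub>Q\<^esub>"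
    and no_lift: "\<And>h. h \<in> carrier G \<Longrightarrow> \<pi> h = a \<Longrightarrow> h [^]\<^bsub>G\<^esub> n \<noteq> \<one>\<^bsub>G\<^esub>"
    and fin: "finite \<Omega>" and card: "card \<Omega> = d"
    and act: "\<And>h x. h \<in> carrier G \<Longrightarrow> x \<in> \<Omega> \<Longrightarrow> \<alpha> h x \<in> \<Omega>"
    and act1: "\<And>x. x \<in> \<Omega> \<Longrightarrow> \<alpha> \<one>\<^bsub>G\<^esub> x = x"
    and actm: "\<And>h h' x. h \<in> carrier G \<Longrightarrow> h' \<in> carrier G \<Longrightarrow> x \<in> \<Omega> \<Longrightarrow> \<alpha> (h \<otimes>\<^bsub>G\<^esub> h') x = \<alpha> h (\<alpha> h' x)"
    and faithful: "\<And>h. h \<in> carrier G \<Longrightarrow> (\<And>x. x \<in> \<Omega> \<Longrightarrow> \<alpha> h x = x) \<Longrightarrow> h = \<one>\<^bsub>G\<^esub>"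
  shows "\<exists>(H :: nat monoid) M \<phi>. group H \<and> finite (carrier H) \<and>
         elem_abelian_p_subgroup p M H \<and> M \<noteq> {\<one>\<^bsub>H\<^esub>} \<and> M \<lhd> H \<and>
         (H Mod M) \<cong> Q \<and> nonsplit M H \<and>
         faithful_perm_rep H d \<phi> \<and>
         ((\<forall>x\<in>\<Omega>. \<forall>y\<in>\<Omega>. \<exists>h\<in>carrier G. \<alpha> h x = y) \<longrightarrow> transitive_perm_rep H d \<phi>)"
proof -
  interpret group_hom G Q \<pi> by fact
  obtain H :: "nat monoid" and e where H: "group H" and e: "e \<in> iso H G"
    using finite_group_iso_nat[OF G.is_group finG] by blast
  interpret nat: group H by fact
  interpret e: group_hom H G e
    using e by (simp add: group_hom_def group_hom_axioms_def iso_def H G.is_group)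
  have eimg: "e ` carrier H = carrier G" and einj: "inj_on e (carrier H)"
    using e by (auto simp: iso_def bij_betw_def)
  have e_one: "x = \<one>\<^bsub>H\<^esub>" if "x \<in> carrier H" "e x = \<one>" for x
    using that einj by (metis nat.one_closed e.hom_one inj_onD)
  interpret c: group_hom H Q "\<pi> \<circ> e"
    using Group.hom_compose[OF e.homh homh] by (simp add: group_hom_def group_hom_axioms_def H)
  define M where "M = kernel H Q (\<pi> \<circ> e)"
  have cimg: "(\<pi> \<circ> e) ` carrier H = carrier Q"
    using eimg surj by (metis image_comp)
  have eM: "x \<in> carrier H \<and> e x \<in> kernel G Q \<pi>" if "x \<in> M" for x
    using that by (auto simp: M_def kernel_def)
  have elem: "elem_abelian_p_subgroup p M H"
    unfolding elem_abelian_p_subgroup_def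
  proof (intro conjI ballI)
    show "subgroup M H" unfolding M_def by (rule c.subgroup_kernel)
    fix x assume x: "x \<in> M"
    show "x [^]\<^bsub>H\<^esub> p = \<one>\<^bsub>H\<^esub>"
      by (rule e_one) (use eM[OF x] expo in \<open>auto simp: e.hom_nat_pow\<close>)
    fix y assume y: "y \<in> M"
    have "e (x \<otimes>\<^bsub>H\<^esub> y) = e (y \<otimes>\<^bsub>H\<^esub> x)"
      using eM[OF x] eM[OF y] comm[of "e x" "e y"] by simp
    then show "x \<otimes>\<^bsub>H\<^esub> y = y \<otimes>\<^bsub>H\<^esub> x"
      using einj eM[OF x] eM[OF y] by (meson nat.m_closed inj_onD)
  qed
  have ns: "nonsplit M H"
    unfolding M_def
  proof (rule nonsplitI[OF c.group_hom_axioms a cimg])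
    fix h assume h: "h \<in> carrier H" "(\<pi> \<circ> e) h = a"
    then have "e (h [^]\<^bsub>H\<^esub> n) \<noteq> \<one>" using no_lift[of "e h"] by (simp add: e.hom_nat_pow)
    then show "h [^]\<^bsub>H\<^esub> n \<noteq> \<one>\<^bsub>H\<^esub>" by auto
  qed
  then have M1: "M \<noteq> {\<one>\<^bsub>H\<^esub>}"
    using complement_trivial[OF H] unfolding nonsplit_def by blast
  obtain \<phi> where \<phi>: "faithful_perm_rep H d \<phi>"
    "(\<forall>x\<in>\<Omega>. \<forall>y\<in>\<Omega>. \<exists>h\<in>carrier H. (\<alpha> \<circ> e) h x = y) \<longrightarrow> transitive_perm_rep H d \<phi>"
  proof (atomize_elim, rule action_imp_perm_rep[OF H fin card])
    fix h assume h: "h \<in> carrier H" "\<And>x. x \<in> \<Omega> \<Longrightarrow> (\<alpha> \<circ> e) h x = x"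
    then show "h = \<one>\<^bsub>H\<^esub>" using faithful[of "e h"] e_one by auto
  qed (auto simp: act act1 actm)
  moreover have "\<forall>x\<in>\<Omega>. \<forall>y\<in>\<Omega>. \<exists>h\<in>carrier H. (\<alpha> \<circ> e) h x = y"
    if "\<forall>x\<in>\<Omega>. \<forall>y\<in>\<Omega>. \<exists>h\<in>carrier G. \<alpha> h x = y"
    using that eimg unfolding o_def by (metis imageE)
  moreover have "finite (carrier H)"
    using finG eimg einj by (metis finite_imageD)
  moreover have "M \<lhd> H" "(H Mod M) \<cong> Q"
    using c.normal_kernel c.FactGroup_iso[OF cimg] by (auto simp: M_def)
  ultimately show ?thesis using H elem M1 ns by blast
qed

section \<open>Extensions by weights on ordered pairs\<close>

definition opairs :: "nat \<Rightarrow> (nat \<times> nat) set" where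
  "opairs k = {(i, j). i \<in> {1..k} \<and> j \<in> {1..k} \<and> i \<noteq> j}"

text \<open>Residues are represented in [0, p) and extended by 0, so that equal weights are equal
  functions.\<close>

definition weights :: "nat \<Rightarrow> nat \<Rightarrow> (nat \<times> nat \<Rightarrow> int) set" where
  "weights k p = {f. \<forall>x. (x \<in> opairs k \<longrightarrow> f x \<in> {0..<int p}) \<and> (x \<notin> opairs k \<longrightarrow> f x = 0)}"

definition mult_weight :: "nat \<Rightarrow> (nat \<times> nat \<Rightarrow> int) \<Rightarrow> (nat \<times> nat \<Rightarrow> int) \<Rightarrow> (nat \<Rightarrow> nat) \<Rightarrow> nat \<times> nat \<Rightarrow> int" where
  "mult_weight p f f' g = (\<lambda>x. (f' x + f (map_prod g g x)) mod int p)"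

text \<open>Solves \<open>mult_weight p f' f g = 0\<close> for f', which makes it the weight of the
  left inverse of (f, g).\<close>

definition inv_weight :: "nat \<Rightarrow> (nat \<times> nat \<Rightarrow> int) \<Rightarrow> (nat \<Rightarrow> nat) \<Rightarrow> nat \<times> nat \<Rightarrow> int" where
  "inv_weight p f g = (\<lambda>x. (- f (map_prod (inv' g) (inv' g) x)) mod int p)"

text \<open>The relation \<open>Z g f\<close> stands for the equation between the image of f and the
  cocycle value at g. No quotient module has to be built, and Z can also carry linear constraints on
  f.\<close>

definition weighted_ext ::
  "nat \<Rightarrow> nat \<Rightarrow> ((nat \<Rightarrow> nat) \<Rightarrow> (nat \<times> nat \<Rightarrow> int) \<Rightarrow> bool) \<Rightarrow> ((nat \<times> nat \<Rightarrow> int) \<times> (nat \<Rightarrow> nat)) monoid" where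
  "weighted_ext k p Z =
    \<lparr>carrier = {(f, g). f \<in> weights k p \<and> g \<in> carrier (alt_group k) \<and> Z g f},
     monoid.mult = \<lambda>(f, g) (f', g'). (mult_weight p f f' g', g \<circ> g'),
     one = (\<lambda>_. 0, id)\<rparr>"

text \<open>The weight \<open>f x\<close> is added at the source \<open>x\<close> before \<open>g\<close> moves it, whence the cocycle
  rule in \<open>mult_weight\<close>.\<close>

definition weight_act :: "nat \<Rightarrow> (nat \<times> nat \<Rightarrow> int) \<times> (nat \<Rightarrow> nat) \<Rightarrow> (nat \<times> nat) \<times> int \<Rightarrow> (nat \<times> nat) \<times> int" where
  "weight_act p = (\<lambda>(f, g) (x, e). (map_prod g g x, (e + f x) mod int p))"

definition weight_points :: "nat \<Rightarrow> nat \<Rightarrow> ((nat \<times> nat) \<times> int) set" where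
  "weight_points k p = opairs k \<times> {0..<int p}"

lemma opairs_iff [simp]: "(i, j) \<in> opairs k \<longleftrightarrow> i \<in> {1..k} \<and> j \<in> {1..k} \<and> i \<noteq> j"
  by (simp add: opairs_def)

lemma opairs_eq: "opairs k = (SIGMA i:{1..k}. {1..k} - {i})"
  by auto

lemma finite_opairs [simp]: "finite (opairs k)"
  by (simp add: opairs_eq)

lemma card_opairs: "card (opairs k) = k * (k - 1)"
  by (simp add: opairs_eq)

lemma finite_weights: "finite (weights k p)"
  unfolding weights_def by (intro finite_set_of_finite_funs) auto

lemma finite_weight_points: "finite (weight_points k p)"
  by (simp add: weight_points_def)

lemma card_weight_points: "card (weight_points k p) = p * k * (k - 1)"
  by (simp add: weight_points_def card_opairs)

lemma permutes_map_opairs: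
  assumes "g permutes {1..k}"
  shows "map_prod g g x \<in> opairs k \<longleftrightarrow> x \<in> opairs k"
  using assms permutes_in_image[OF assms] permutes_inj[OF assms]
  by (cases x) (auto simp: inj_eq simp del: atLeastAtMost_iff)

lemma permutes_interval_imp_permutation: "g permutes {Suc 0..k} \<Longrightarrow> permutation g"
  by (rule permutes_imp_permutation) auto

lemma weightsI:
  assumes "\<And>x. x \<in> opairs k \<Longrightarrow> 0 \<le> f x \<and> f x < int p" and "\<And>x. x \<notin> opairs k \<Longrightarrow> f x = 0"
  shows "f \<in> weights k p"
  using assms by (simp add: weights_def del: split_paired_All)

lemma weights_off: "f \<in> weights k p \<Longrightarrow> x \<notin> opairs k \<Longrightarrow> f x = 0"
  by (simp add: weights_def del: split_paired_All)

lemma zero_weight: "p > 0 \<Longrightarrow> (\<lambda>_. 0) \<in> weights k p"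
  by (simp add: weights_def)

lemma weights_mod: "f \<in> weights k p \<Longrightarrow> f x mod int p = f x"
  by (cases "x \<in> opairs k") (auto simp: weights_def simp del: split_paired_All)

lemma mult_weight_closed:
  assumes "p > 0" "f \<in> weights k p" "f' \<in> weights k p" "g permutes {1..k}"
  shows "mult_weight p f f' g \<in> weights k p"
  using assms by (intro weightsI) (simp_all add: mult_weight_def permutes_map_opairs weights_off)

lemma inv_weight_closed:
  assumes "p > 0" "f \<in> weights k p" "g permutes {1..k}"
  shows "inv_weight p f g \<in> weights k p"
  using assms by (intro weightsI) (simp_all add: inv_weight_def weights_off permutes_map_opairs[OF permutes_inv[OF assms(3)]])

lemma pow_alt_group: "a [^]\<^bsub>alt_group k\<^esub> (n::nat) = a ^^ n"
proof (induction n)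
  case (Suc n)
  then show ?case by (simp only: nat_pow_Suc alt_group_mult funpow_Suc_right)
qed (simp add: alt_group_one)

text \<open>The first three conditions on Z give closure under the group operations;
  \<open>Z_ex\<close> makes the projection onto the alternating group surjective. Three points are
  enough for a permutation to be determined by its action on unordered pairs.\<close>

locale weight_cocycle =
  fixes k p :: nat and Z :: "(nat \<Rightarrow> nat) \<Rightarrow> (nat \<times> nat \<Rightarrow> int) \<Rightarrow> bool"
  assumes p: "p > 1" and k: "k \<ge> 3"
    and Z_one: "Z id (\<lambda>_. 0)"
    and Z_mult: "\<And>f g f' g'. \<lbrakk>f \<in> weights k p; f' \<in> weights k p; g permutes {1..k}; g' permutes {1..k}; Z g f; Z g' f'\<rbrakk>
      \<Longrightarrow> Z (g \<circ> g') (mult_weight p f f' g')"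
    and Z_inv: "\<And>f g. \<lbrakk>f \<in> weights k p; g permutes {1..k}; Z g f\<rbrakk> \<Longrightarrow> Z (inv' g) (inv_weight p f g)"
    and Z_ex: "\<And>g. g permutes {1..k} \<Longrightarrow> \<exists>f\<in>weights k p. Z g f"
begin

abbreviation "G \<equiv> weighted_ext k p Z"

lemma carrier_iff:
  "(f, g) \<in> carrier G \<longleftrightarrow> f \<in> weights k p \<and> g permutes {1..k} \<and> evenperm g \<and> Z g f"
  by (simp add: weighted_ext_def alt_group_carrier)

lemma mult_eq: "(f, g) \<otimes>\<^bsub>G\<^esub> (f', g') = (mult_weight p f f' g', g \<circ> g')"
  by (simp add: weighted_ext_def)

lemma one_eq: "\<one>\<^bsub>G\<^esub> = (\<lambda>_. 0, id)"
  by (simp add: weighted_ext_def)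

lemma group: "group G"
proof (rule groupI)
  fix h h' assume "h \<in> carrier G" "h' \<in> carrier G"
  then show "h \<otimes>\<^bsub>G\<^esub> h' \<in> carrier G"
    using p Z_mult
    by (cases h; cases h')
      (auto simp: carrier_iff mult_eq mult_weight_closed permutes_compose evenperm_comp permutes_interval_imp_permutation)
next
  show "\<one>\<^bsub>G\<^esub> \<in> carrier G"
    using p Z_one by (simp add: carrier_iff one_eq zero_weight permutes_id)
next
  fix h h' h'' assume "h \<in> carrier G" "h' \<in> carrier G" "h'' \<in> carrier G"
  then show "h \<otimes>\<^bsub>G\<^esub> h' \<otimes>\<^bsub>G\<^esub> h'' = h \<otimes>\<^bsub>G\<^esub> (h' \<otimes>\<^bsub>G\<^esub> h'')"
    by (cases h; cases h'; cases h'')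
      (auto simp: mult_eq mult_weight_def comp_assoc fun_eq_iff mod_simps ac_simps)
next
  fix h assume "h \<in> carrier G"
  then show "\<one>\<^bsub>G\<^esub> \<otimes>\<^bsub>G\<^esub> h = h"
    by (cases h) (auto simp: carrier_iff mult_eq one_eq mult_weight_def weights_mod)
next
  fix h assume h: "h \<in> carrier G"
  obtain f g where hfg: "h = (f, g)" by (cases h)
  have "(inv_weight p f g, inv' g) \<in> carrier G"
    using h p Z_inv
    by (auto simp: hfg carrier_iff inv_weight_closed permutes_inv evenperm_inv permutes_interval_imp_permutation)
  moreover have "(inv_weight p f g, inv' g) \<otimes>\<^bsub>G\<^esub> h = \<one>\<^bsub>G\<^esub>"
    using h by (auto simp: hfg carrier_iff mult_eq one_eq mult_weight_def inv_weight_def fun_eq_iff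
        permutes_inverses mod_simps)
  ultimately show "\<exists>h'\<in>carrier G. h' \<otimes>\<^bsub>G\<^esub> h = \<one>\<^bsub>G\<^esub>" by blast
qed

lemma group_hom_snd: "group_hom G (alt_group k) snd"
  using group alt_group_is_group
  by (auto simp: group_hom_def group_hom_axioms_def hom_def carrier_iff mult_eq alt_group_carrier alt_group_mult)

lemma snd_surj: "snd ` carrier G = carrier (alt_group k)"
proof
  show "carrier (alt_group k) \<subseteq> snd ` carrier G"
  proof
    fix g assume g: "g \<in> carrier (alt_group k)"
    then obtain f where "f \<in> weights k p" "Z g f" using Z_ex by (auto simp: alt_group_carrier)
    then have "(f, g) \<in> carrier G" using g by (simp add: carrier_iff alt_group_carrier)
    then show "g \<in> snd ` carrier G" by force
  qed
qed (auto simp: carrier_iff alt_group_carrier)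

lemma finite_carrier: "finite (carrier G)"
proof (rule finite_subset)
  show "carrier G \<subseteq> weights k p \<times> {g. g permutes {1..k}}"
    by (auto simp: carrier_iff)
qed (simp add: finite_weights finite_permutations)

text \<open>The weight of a power adds up f along the path of x under g. Hence a trivial power means
  vanishing path sums, the source of both obstructions.\<close>

lemma pow_eq:
  "(f, g) [^]\<^bsub>G\<^esub> (n::nat) =
    (\<lambda>x. (\<Sum>t<n. f (map_prod (g ^^ t) (g ^^ t) x)) mod int p, g ^^ n)"
proof (induction n)
  case (Suc n)
  show ?case
    unfolding nat_pow_Suc Suc mult_eq
    by (auto simp: mult_weight_def fun_eq_iff sum.lessThan_Suc_shift mod_simps funpow_swap1 simp del: sum.lessThan_Suc)
qed (auto simp: one_eq)

lemma pow_eq_oneD: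
  assumes "(f, g) [^]\<^bsub>G\<^esub> (n::nat) = \<one>\<^bsub>G\<^esub>"
  shows "(\<Sum>t<n. f (map_prod (g ^^ t) (g ^^ t) x)) mod int p = 0"
  using assms unfolding pow_eq one_eq prod.inject by meson

lemma kernel_iff: "(f, g) \<in> kernel G (alt_group k) snd \<longleftrightarrow> f \<in> weights k p \<and> Z id f \<and> g = id"
  by (auto simp: kernel_def carrier_iff alt_group_one permutes_id)

lemma kernel_comm:
  "x \<in> kernel G (alt_group k) snd \<Longrightarrow> y \<in> kernel G (alt_group k) snd \<Longrightarrow> x \<otimes>\<^bsub>G\<^esub> y = y \<otimes>\<^bsub>G\<^esub> x"
  by (cases x; cases y) (auto simp: kernel_iff mult_eq mult_weight_def map_prod.id add.commute)

lemma kernel_exponent: "x \<in> kernel G (alt_group k) snd \<Longrightarrow> x [^]\<^bsub>G\<^esub> p = \<one>\<^bsub>G\<^esub>"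
  by (cases x) (auto simp: kernel_iff pow_eq one_eq map_prod.id)

lemma act_closed:
  "h \<in> carrier G \<Longrightarrow> x \<in> weight_points k p \<Longrightarrow> weight_act p h x \<in> weight_points k p"
  using p by (auto simp: weight_points_def weight_act_def carrier_iff permutes_map_opairs
      simp del: opairs_iff map_prod_simp split: prod.splits)

lemma act_one: "x \<in> weight_points k p \<Longrightarrow> weight_act p \<one>\<^bsub>G\<^esub> x = x"
  by (auto simp: weight_points_def weight_act_def one_eq)

lemma act_mult:
  "h \<in> carrier G \<Longrightarrow> h' \<in> carrier G \<Longrightarrow> weight_act p (h \<otimes>\<^bsub>G\<^esub> h') x = weight_act p h (weight_act p h' x)"
  by (cases h; cases h'; cases x) (auto simp: weight_act_def mult_eq mult_weight_def mod_simps ac_simps)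

text \<open>Only unordered pairs are assumed to be kept, so that the lemma applies both to labelled
  ordered pairs and to their classes under reversal.\<close>

lemma act_faithful:
  assumes h: "h \<in> carrier G" and fix_pairs: "\<And>i j. (i, j) \<in> opairs k \<Longrightarrow>
      {(i,j),(j,i)} = {map_prod (snd h) (snd h) (i,j), map_prod (snd h) (snd h) (j,i)}"
    and fix_points: "\<And>x e. (x, e) \<in> weight_points k p \<Longrightarrow> snd h = id \<Longrightarrow> weight_act p h (x, e) = (x, e)"
  shows "h = \<one>\<^bsub>G\<^esub>"
proof -
  obtain f g where hfg: "h = (f, g)" by (cases h)
  have f: "f \<in> weights k p" and g: "g permutes {1..k}" using h by (auto simp: hfg carrier_iff)
  have "g i = i" for i
  proof (cases "i \<in> {1..k}")
    case True
    \<comment> \<open>The pairs {i, a} and {i, b} are both kept by g and meet only in i.\<close>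
    have "\<not> card ({1..k} - {i}) \<le> Suc 0" using True k by simp
    with card_le_Suc0_iff_eq[of "{1..k} - {i}"] obtain a b where ab: "a \<in> {1..k} - {i}" "b \<in> {1..k} - {i}" "a \<noteq> b"
      by blast
    show ?thesis
      using fix_pairs[of i a] fix_pairs[of i b] ab True by (auto simp: hfg doubleton_eq_iff)
  qed (use g in \<open>auto simp: permutes_def\<close>)
  then have gid: "g = id" by auto
  have "f x = 0" for x
  proof (cases "x \<in> opairs k")
    case True
    then show ?thesis
      using fix_points[of x 0] gid p f by (auto simp: hfg weight_points_def weight_act_def weights_mod)
  qed (use f in \<open>simp add: weights_off\<close>)
  then show ?thesis using gid by (auto simp: hfg one_eq)
qed

end

section \<open>The case of characteristic two\<close>

text \<open>Some permutation does the job; if it is odd, it is followed by a transposition of two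
  points other than i' and j', which exist because k is at least 4.\<close>

lemma ex_even_two_transitive:
  assumes "k \<ge> 4" and ij: "(i, j) \<in> opairs k" "(i', j') \<in> opairs k"
  shows "\<exists>g. g permutes {1..k} \<and> evenperm g \<and> g i = i' \<and> g j = j'"
proof -
  \<comment> \<open>First i goes to i', then the image of j goes to j'. The second transposition
    leaves i' alone.\<close>
  define g where "g = transpose (transpose i i' j) j' \<circ> transpose i i'"
  have g: "g permutes {1..k}"
    unfolding g_def using ij
    by (intro permutes_compose permutes_swap_id) (auto simp: transpose_def)
  have gij: "g i = i'" "g j = j'"
    using ij by (auto simp: g_def transpose_def)
  show ?thesis
  proof (cases "evenperm g")
    case False
    have "\<not> card ({1..k} - {i', j'}) \<le> Suc 0" using ij assms(1) by simp
    with card_le_Suc0_iff_eq[of "{1..k} - {i', j'}"]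
    obtain a b where ab: "a \<in> {1..k} - {i', j'}" "b \<in> {1..k} - {i', j'}" "a \<noteq> b"
      by blast
    have t: "transpose a b permutes {1..k}"
      using ab by (intro permutes_swap_id) auto
    have "evenperm (transpose a b \<circ> g)"
      using evenperm_comp[OF permutes_imp_permutation[OF _ t] permutes_imp_permutation[OF _ g]] False ab
      by (simp add: evenperm_swap)
    moreover have "(transpose a b \<circ> g) i = i'" "(transpose a b \<circ> g) j = j'"
      using gij ab by (auto simp: transpose_def)
    ultimately show ?thesis using permutes_compose[OF g t] by blast
  qed (use g gij in blast)
qed

definition flip_cocycle :: "nat \<Rightarrow> (nat \<Rightarrow> nat) \<Rightarrow> (nat \<times> nat \<Rightarrow> int) \<Rightarrow> bool" where
  "flip_cocycle k g f \<longleftrightarrow>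
    (\<forall>i j. (i, j) \<in> opairs k \<longrightarrow> even (f (i, j) + f (j, i)) = ((i < j) = (g i < g j)))"

text \<open>A composite reverses the order of a pair iff exactly one of its factors does, the outer
  one being tested at the image of the pair. This is the cocycle rule modulo 2.\<close>

lemma weight_cocycle_flip:
  assumes "k \<ge> 3" shows "weight_cocycle k 2 (flip_cocycle k)"
proof
  show "flip_cocycle k id (\<lambda>_. 0)" by (simp add: flip_cocycle_def)
next
  fix f g f' g'
  assume g: "g permutes {1..k}" "g' permutes {1..k}" and Z: "flip_cocycle k g f" "flip_cocycle k g' f'"
  show "flip_cocycle k (g \<circ> g') (mult_weight 2 f f' g')"
    unfolding flip_cocycle_def
  proof (intro allI impI)
    fix i j assume ij: "(i, j) \<in> opairs k"
    then have "(g' i, g' j) \<in> opairs k" using permutes_map_opairs[OF g(2), of "(i, j)"] by simp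
    then have "even (f (g' i, g' j) + f (g' j, g' i)) = ((g' i < g' j) = (g (g' i) < g (g' j)))"
      "even (f' (i, j) + f' (j, i)) = ((i < j) = (g' i < g' j))"
      using Z ij unfolding flip_cocycle_def by blast+
    then show "even (mult_weight 2 f f' g' (i, j) + mult_weight 2 f f' g' (j, i)) =
        ((i < j) = ((g \<circ> g') i < (g \<circ> g') j))"
      by (auto simp: mult_weight_def)
  qed
next
  fix f g assume g: "g permutes {1..k}" and Z: "flip_cocycle k g f"
  show "flip_cocycle k (inv' g) (inv_weight 2 f g)"
    unfolding flip_cocycle_def
  proof (intro allI impI)
    fix i j assume ij: "(i, j) \<in> opairs k"
    then have "(inv' g i, inv' g j) \<in> opairs k"
      using permutes_map_opairs[OF permutes_inv[OF g], of "(i, j)"] by simp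
    then have "even (f (inv' g i, inv' g j) + f (inv' g j, inv' g i)) = ((inv' g i < inv' g j) = (i < j))"
      using Z permutes_inverses[OF g] unfolding flip_cocycle_def by simp
    then show "even (inv_weight 2 f g (i, j) + inv_weight 2 f g (j, i)) = ((i < j) = (inv' g i < inv' g j))"
      by (auto simp: inv_weight_def)
  qed
next
  fix g assume g: "g permutes {1..k}"
  \<comment> \<open>For each reversed pair the weight 1 is put on the ascending order only, so that
    the two orders have odd sum.\<close>
  define f :: "nat \<times> nat \<Rightarrow> int" where "f = (\<lambda>(i, j). of_bool ((i, j) \<in> opairs k \<and> i < j \<and> g j < g i))"
  have "f \<in> weights k 2" by (rule weightsI) (auto simp: f_def)
  moreover have "flip_cocycle k g f"
    unfolding flip_cocycle_def
  proof (intro allI impI)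
    fix i j assume ij: "(i, j) \<in> opairs k"
    then have "g i \<noteq> g j" using permutes_inj[OF g] by (simp add: inj_eq)
    then show "even (f (i, j) + f (j, i)) = ((i < j) = (g i < g j))"
      using ij by (auto simp: f_def)
  qed
  ultimately show "\<exists>f\<in>weights k 2. flip_cocycle k g f" by blast
qed (use assms in auto)

theorem nonsplit_extension_alt_2:
  assumes k4: "k \<ge> 4"
  shows "\<exists>(H :: nat monoid) M \<phi>. group H \<and> finite (carrier H) \<and>
         elem_abelian_p_subgroup 2 M H \<and> M \<noteq> {\<one>\<^bsub>H\<^esub>} \<and> M \<lhd> H \<and>
         (H Mod M) \<cong> alt_group k \<and> nonsplit M H \<and>
         faithful_perm_rep H (2 * k * (k - 1)) \<phi> \<and>
         transitive_perm_rep H (2 * k * (k - 1)) \<phi>"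
proof -
  interpret weight_cocycle k 2 "flip_cocycle k"
    by (rule weight_cocycle_flip) (use k4 in simp)
  \<comment> \<open>The swap of 1 and 2 produces the obstruction; the swap of 3 and 4 makes the
    permutation even.\<close>
  define a :: "nat \<Rightarrow> nat" where "a = transpose 1 2 \<circ> transpose 3 4"
  have "a permutes {1..k}" "evenperm a"
    using k4 by (auto simp: a_def intro!: permutes_compose permutes_swap_id)
      (auto simp: evenperm_comp permutation_swap_id evenperm_swap)
  then have a: "a \<in> carrier (alt_group k)" by (simp add: alt_group_carrier)
  have a2: "a [^]\<^bsub>alt_group k\<^esub> (2::nat) = \<one>\<^bsub>alt_group k\<^esub>"
    unfolding pow_alt_group by (auto simp: alt_group_one numeral_2_eq_2 a_def fun_eq_iff transpose_def)
  have no_lift: "h [^]\<^bsub>G\<^esub> (2::nat) \<noteq> \<one>\<^bsub>G\<^esub>" if h: "h \<in> carrier G" "snd h = a" for h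
  proof
    obtain f where hf: "h = (f, a)" using h(2) by (cases h) auto
    assume "h [^]\<^bsub>G\<^esub> (2::nat) = \<one>\<^bsub>G\<^esub>"
    \<comment> \<open>The path of (1, 2) consists of (1, 2) and (2, 1), so its sum would be even,
      whereas the cocycle makes it odd because \<open>a\<close> reverses this pair.\<close>
    then have "(\<Sum>t<2. f (map_prod (a ^^ t) (a ^^ t) (1, 2))) mod int 2 = 0"
      unfolding hf by (rule pow_eq_oneD)
    then have "even (f (1, 2) + f (2, 1))"
      by (simp add: numeral_2_eq_2 a_def even_iff_mod_2_eq_zero)
    moreover have "flip_cocycle k a f" using h hf by (simp add: carrier_iff)
    moreover have "(1, 2) \<in> opairs k" using k4 by simp
    ultimately have "(1 < (2::nat)) = (a 1 < a 2)" unfolding flip_cocycle_def by blast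
    then show False by (simp add: a_def)
  qed
  have trans: "\<exists>h\<in>carrier G. weight_act 2 h y = z"
    if yz: "y \<in> weight_points k 2" "z \<in> weight_points k 2" for y z
  proof -
    obtain i j e where y: "y = ((i, j), e)" by (cases y) auto
    obtain i' j' e' where z: "z = ((i', j'), e')" by (cases z) auto
    have pairs: "(i, j) \<in> opairs k" "(i', j') \<in> opairs k"
      and e: "e \<in> {0..<2}" "e' \<in> {0..<2}"
      using yz unfolding y z weight_points_def by auto
    obtain g where g: "g permutes {1..k}" "evenperm g" "g i = i'" "g j = j'"
      using ex_even_two_transitive[OF k4 pairs] by blast
    obtain f where f: "f \<in> weights k 2" "flip_cocycle k g f"
      using Z_ex[OF g(1)] by blast
    \<comment> \<open>A correction of the label that turns e into e'. It has to be symmetric in the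
      pair to leave the cocycle condition intact, hence the same value on (j, i).\<close>
    define c where "c x = (if x \<in> {(i, j), (j, i)} then e' - e - f (i, j) else 0)" for x
    define f' where "f' x = (f x + c x) mod 2" for x
    have c_off: "c x = 0" if "x \<notin> opairs k" for x
    proof -
      have "(j, i) \<in> opairs k" using pairs by simp
      then have "x \<notin> {(i, j), (j, i)}" using that pairs by blast
      then show ?thesis by (simp add: c_def)
    qed
    have c_sym: "c (b, a) = c (a, b)" for a b
      by (simp add: c_def conj_commute disj_commute)
    have f'w: "f' \<in> weights k 2"
      by (rule weightsI) (simp_all add: f'_def c_off weights_off[OF f(1)])
    have "even (f' (a, b) + f' (b, a)) = even (f (a, b) + f (b, a))" for a b
      unfolding f'_def c_sym[of a b] by auto
    then have f'Z: "flip_cocycle k g f'"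
      using f(2) by (simp add: flip_cocycle_def)
    have cij: "c (i, j) = e' - e - f (i, j)" by (simp add: c_def)
    have "(f', g) \<in> carrier G" using f'w f'Z g by (simp add: carrier_iff)
    moreover have "weight_act 2 (f', g) y = z"
      using g e by (simp add: y z weight_act_def f'_def cij mod_simps)
    ultimately show ?thesis by blast
  qed
  have faithful: "h = \<one>\<^bsub>G\<^esub>"
    if h: "h \<in> carrier G" and fixed: "\<And>x. x \<in> weight_points k 2 \<Longrightarrow> weight_act 2 h x = x" for h
  proof (rule act_faithful[OF h])
    fix i j assume "(i, j) \<in> opairs k"
    then have "weight_act 2 h ((i, j), 0) = ((i, j), 0)"
      by (intro fixed) (simp add: weight_points_def)
    then show "{(i, j), (j, i)} = {map_prod (snd h) (snd h) (i, j), map_prod (snd h) (snd h) (j, i)}"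
      by (cases h) (simp add: weight_act_def)
  qed (rule fixed)
  have trans': "\<forall>y\<in>weight_points k 2. \<forall>z\<in>weight_points k 2. \<exists>h\<in>carrier G. weight_act 2 h y = z"
    using trans by blast
  show ?thesis
    using realize_extension[OF group_hom_snd finite_carrier snd_surj kernel_comm kernel_exponent a a2
        no_lift finite_weight_points card_weight_points act_closed act_one act_mult faithful]
    unfolding eqTrueI[OF trans'] simp_thms .
qed

section \<open>The case of odd characteristic\<close>

text \<open>The first clause is antisymmetry. In the second, the right side is the unit vector at 1
  composed with g, minus the unit vector itself.\<close>

definition boundary_cocycle :: "nat \<Rightarrow> nat \<Rightarrow> (nat \<Rightarrow> nat) \<Rightarrow> (nat \<times> nat \<Rightarrow> int) \<Rightarrow> bool" where
  "boundary_cocycle k p g f \<longleftrightarrow>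
    (\<forall>i j. [f (i, j) + f (j, i) = 0] (mod int p)) \<and>
    (\<forall>i\<in>{1..k}. [(\<Sum>j=1..k. f (i, j)) = of_bool (g i = 1) - of_bool (i = 1)] (mod int p))"

lemma weight_cocycle_boundary:
  assumes "k \<ge> 3" "p > 1" shows "weight_cocycle k p (boundary_cocycle k p)"
proof
  show "boundary_cocycle k p id (\<lambda>_. 0)" by (simp add: boundary_cocycle_def)
next
  fix f g f' g'
  assume g: "g permutes {1..k}" "g' permutes {1..k}"
    and Z: "boundary_cocycle k p g f" "boundary_cocycle k p g' f'"
  let ?m = "mult_weight p f f' g'"
  have m: "[?m (i, j) = f' (i, j) + f (g' i, g' j)] (mod int p)" for i j
    by (simp add: mult_weight_def)
  show "boundary_cocycle k p (g \<circ> g') ?m"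
    unfolding boundary_cocycle_def
  proof (intro conjI allI ballI)
    fix i j
    have "[?m (i, j) + ?m (j, i) = (f' (i, j) + f (g' i, g' j)) + (f' (j, i) + f (g' j, g' i))] (mod int p)"
      by (intro cong_add m)
    also have "(f' (i, j) + f (g' i, g' j)) + (f' (j, i) + f (g' j, g' i)) =
        (f' (i, j) + f' (j, i)) + (f (g' i, g' j) + f (g' j, g' i))" by simp
    also have "[\<dots> = 0 + 0] (mod int p)"
      using Z unfolding boundary_cocycle_def by (intro cong_add) blast+
    finally show "[?m (i, j) + ?m (j, i) = 0] (mod int p)" by simp
  next
    fix i assume i: "i \<in> {1..k}"
    then have i': "g' i \<in> {1..k}" using permutes_in_image[OF g(2)] by blast
    have "[(\<Sum>j=1..k. ?m (i, j)) = (\<Sum>j=1..k. f' (i, j) + f (g' i, g' j))] (mod int p)"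
      by (intro cong_sum m)
    also have "(\<Sum>j=1..k. f' (i, j) + f (g' i, g' j)) = (\<Sum>j=1..k. f' (i, j)) + (\<Sum>j=1..k. f (g' i, j))"
      using sum.permute[OF g(2), of "\<lambda>j. f (g' i, j)"] by (simp add: sum.distrib o_def)
    \<comment> \<open>The sum telescopes: the terms testing g' i = 1 cancel.\<close>
    also have "[\<dots> = (of_bool (g' i = 1) - of_bool (i = 1)) + (of_bool (g (g' i) = 1) - of_bool (g' i = 1))] (mod int p)"
      using Z i i' unfolding boundary_cocycle_def by (intro cong_add) blast+
    finally show "[(\<Sum>j=1..k. ?m (i, j)) = of_bool ((g \<circ> g') i = 1) - of_bool (i = 1)] (mod int p)"
      by (simp del: One_nat_def)
  qed
next
  fix f g assume g: "g permutes {1..k}" and Z: "boundary_cocycle k p g f"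
  let ?m = "inv_weight p f g" and ?g = "inv' g"
  have m: "[?m (i, j) = - f (?g i, ?g j)] (mod int p)" for i j
    by (simp add: inv_weight_def)
  show "boundary_cocycle k p ?g ?m"
    unfolding boundary_cocycle_def
  proof (intro conjI allI ballI)
    fix i j
    have "[?m (i, j) + ?m (j, i) = - f (?g i, ?g j) + - f (?g j, ?g i)] (mod int p)"
      by (intro cong_add m)
    also have "- f (?g i, ?g j) + - f (?g j, ?g i) = - (f (?g i, ?g j) + f (?g j, ?g i))" by simp
    also have "[\<dots> = - 0] (mod int p)"
      using Z unfolding boundary_cocycle_def by (subst cong_minus_minus_iff) blast
    finally show "[?m (i, j) + ?m (j, i) = 0] (mod int p)" by simp
  next
    fix i assume i: "i \<in> {1..k}"
    then have i': "?g i \<in> {1..k}" using permutes_in_image[OF permutes_inv[OF g]] by blast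
    have "[(\<Sum>j=1..k. ?m (i, j)) = (\<Sum>j=1..k. - f (?g i, ?g j))] (mod int p)"
      by (intro cong_sum m)
    also have "(\<Sum>j=1..k. - f (?g i, ?g j)) = - (\<Sum>j=1..k. f (?g i, j))"
      using sum.permute[OF permutes_inv[OF g], of "\<lambda>j. f (?g i, j)"] by (simp add: sum_negf o_def)
    also have "[\<dots> = - (of_bool (g (?g i) = 1) - of_bool (?g i = 1))] (mod int p)"
      using Z i' unfolding boundary_cocycle_def by (subst cong_minus_minus_iff) blast
    finally show "[(\<Sum>j=1..k. ?m (i, j)) = of_bool (?g i = 1) - of_bool (i = 1)] (mod int p)"
      using permutes_inverses[OF g] by (simp del: One_nat_def)
  qed
next
  fix g assume g: "g permutes {1..k}"
  define a where "a = inv' g 1"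
  have a: "a \<in> {1..k}" using permutes_in_image[OF permutes_inv[OF g], of 1] assms by (simp add: a_def)
  have ga: "g i = 1 \<longleftrightarrow> i = a" for i
    using permutes_inverses[OF g] unfolding a_def by metis
  \<comment> \<open>A unit flow between a, the preimage of 1, and 1 itself: its divergence is 1 at a
    and -1 at 1, and it vanishes when a = 1.\<close>
  define f0 :: "nat \<times> nat \<Rightarrow> int" where
    "f0 = (\<lambda>(i, j). of_bool (i = a) * of_bool (j = 1) - of_bool (i = 1) * of_bool (j = a))"
  define f where "f = (\<lambda>x. f0 x mod int p)"
  have f: "[f x = f0 x] (mod int p)" for x by (simp add: f_def)
  have "f \<in> weights k p"
    using a assms by (intro weightsI) (auto simp: f_def f0_def)
  moreover have "boundary_cocycle k p g f"
    unfolding boundary_cocycle_def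
  proof (intro conjI allI ballI)
    fix i j
    have "[f (i, j) + f (j, i) = f0 (i, j) + f0 (j, i)] (mod int p)"
      by (intro cong_add f)
    then show "[f (i, j) + f (j, i) = 0] (mod int p)" by (simp add: f0_def)
  next
    fix i assume "i \<in> {1..k}"
    have "[(\<Sum>j=1..k. f (i, j)) = (\<Sum>j=1..k. f0 (i, j))] (mod int p)"
      by (intro cong_sum f)
    also have "(\<Sum>j=1..k. f0 (i, j)) = of_bool (i = a) - of_bool (i = 1)"
      using a assms by (simp add: f0_def sum_subtractf flip: sum_distrib_left)
    finally show "[(\<Sum>j=1..k. f (i, j)) = of_bool (g i = 1) - of_bool (i = 1)] (mod int p)"
      by (simp only: ga)
  qed
  ultimately show "\<exists>f\<in>weights k p. boundary_cocycle k p g f" by blast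
qed (use assms in auto)

section \<open>Products of k/p disjoint p-cycles on consecutive blocks\<close>

definition block_cycle :: "nat \<Rightarrow> nat \<Rightarrow> nat \<Rightarrow> nat" where
  "block_cycle k p i =
    (if i \<in> {1..k} then p * ((i - 1) div p) + ((i - 1) mod p + 1) mod p + 1 else i)"

lemma block_cycle_pow:
  assumes "p > 0" "p dvd k" "i \<in> {1..k}"
  shows "(block_cycle k p ^^ t) i = p * ((i - 1) div p) + ((i - 1) mod p + t) mod p + 1"
    and "(block_cycle k p ^^ t) i \<in> {1..k}"
proof -
  obtain q where q: "k = p * q" using assms(2) by blast
  have "i - 1 < q * p" using assms(3) q by (auto simp: mult.commute)
  then have "(i - 1) div p < q" by (rule less_mult_imp_div_less)
  \<comment> \<open>As p divides k, the block of i lies entirely within {1..k}.\<close>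
  then have "p * ((i - 1) div p) + p \<le> p * q"
    by (metis Suc_leI mult_Suc_right mult_le_mono2 add.commute)
  then have range: "p * ((i - 1) div p) + s mod p + 1 \<in> {1..k}" for s
    using mod_less_divisor[OF assms(1), of s] q by simp
  show 1: "(block_cycle k p ^^ t) i = p * ((i - 1) div p) + ((i - 1) mod p + t) mod p + 1" for t
  proof (induction t)
    case 0
    then show ?case using assms by simp
  next
    case (Suc t)
    then show ?case using range[of "(i - 1) mod p + t"] assms(1)
      by (simp add: block_cycle_def mod_Suc_eq)
  qed
  show "(block_cycle k p ^^ t) i \<in> {1..k}" unfolding 1 by (rule range)
qed

lemma block_cycle_pow_order:
  assumes "p > 0" "p dvd k" shows "block_cycle k p ^^ p = id"
proof
  fix i
  show "(block_cycle k p ^^ p) i = id i"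
  proof (cases "i \<in> {1..k}")
    case True
    then show ?thesis using block_cycle_pow(1)[OF assms True, of p] by simp
  next
    case False
    then have "(block_cycle k p ^^ t) i = i" for t
      by (induction t) (auto simp: block_cycle_def)
    then show ?thesis by simp
  qed
qed

lemma block_cycle_permutes:
  assumes "p > 0" "p dvd k" shows "block_cycle k p permutes {1..k}"
proof -
  \<comment> \<open>The power with exponent m = p - 1 is the inverse.\<close>
  obtain m where m: "p = Suc m" using assms(1) by (cases p) auto
  have "block_cycle k p \<circ> block_cycle k p ^^ m = id" "block_cycle k p ^^ m \<circ> block_cycle k p = id"
    using block_cycle_pow_order[OF assms] unfolding m funpow.simps(2) funpow_Suc_right[symmetric] by simp_all
  then have "bij (block_cycle k p)" using o_bij by blast
  then show ?thesis by (auto simp: permutes_def bij_iff block_cycle_def)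
qed

lemma evenperm_funpow:
  assumes "permutation g" shows "evenperm (g ^^ n) \<longleftrightarrow> evenperm g \<or> even n"
proof (induction n)
  case (Suc n)
  have "permutation (g ^^ n)"
    using assms by (induction n) (auto simp: permutation_compose)
  from evenperm_comp[OF assms this] Suc show ?case
    unfolding funpow.simps(2) even_Suc by blast
qed simp

text \<open>The p-th power is the identity, which is even, and p is odd; so the permutation itself
  is even, with no count of its cycles.\<close>

lemma block_cycle_even:
  assumes "odd p" "p dvd k" shows "evenperm (block_cycle k p)"
proof -
  have p: "p > 0" using assms(1) by (cases p) auto
  have "permutation (block_cycle k p)"
    using block_cycle_permutes[OF p assms(2)] permutes_imp_permutation by blast
  from evenperm_funpow[OF this, of p] show ?thesis
    using assms(1) block_cycle_pow_order[OF p assms(2)] by simp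
qed

text \<open>The wrap-around at the end of a block changes the value by p, so modulo p the cycle is
  the shift by one.\<close>

lemma block_cycle_cong:
  assumes "p > 0" "i \<in> {1..k}" shows "[int (block_cycle k p i) = int i + 1] (mod int p)"
proof -
  have "[p * ((i - 1) div p) + ((i - 1) mod p + 1) mod p + 1 = (i - 1) + 1 + 1] (mod p)"
    unfolding cong_def by (metis mod_add_left_eq mod_mult_self4)
  then have "[block_cycle k p i = i + 1] (mod p)"
    using assms by (simp add: block_cycle_def)
  then show ?thesis by (metis cong_int_iff of_nat_1 of_nat_add)
qed

lemma cong_sum_zero_of_orbit_sums:
  fixes f w :: "nat \<times> nat \<Rightarrow> int"
  assumes p: "p > 0" "p dvd k"
    and orbit: "\<And>x. [(\<Sum>t<p. f (map_prod (block_cycle k p ^^ t) (block_cycle k p ^^ t) x)) = 0] (mod int p)"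
    and w: "\<And>x. x \<in> {1..k} \<times> {1..k} \<Longrightarrow> [w (map_prod (block_cycle k p) (block_cycle k p) x) = w x] (mod int p)"
  shows "[(\<Sum>x\<in>{1..k} \<times> {1..k}. w x * f x) = 0] (mod int p)"
proof -
  let ?g = "block_cycle k p" and ?D = "{1..k} \<times> {1..k}"
  let ?G = "map_prod ?g ?g"
  \<comment> \<open>The vanishing orbit sums make \<open>f\<close> a coboundary \<open>u - u \<circ> a\<close>: sum \<open>f\<close> from \<open>x\<close> to the end of its block.\<close>
  define m where "m x = p - (fst x - 1) mod p" for x :: "nat \<times> nat"
  define u where "u x = (\<Sum>t<m x. f (map_prod (?g ^^ t) (?g ^^ t) x))" for x
  have step: "[f x = u x - u (?G x)] (mod int p)" if x: "x \<in> ?D" for x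
  proof -
    obtain i j where ij: "x = (i, j)" by (cases x)
    let ?r = "(i - 1) mod p"
    have r: "?r < p" using p by simp
    have shift: "(\<Sum>t<n. f (map_prod (?g ^^ t) (?g ^^ t) (?G x))) =
        (\<Sum>t<Suc n. f (map_prod (?g ^^ t) (?g ^^ t) x)) - f x" for n
      by (simp add: ij sum.lessThan_Suc_shift funpow_swap1 del: sum.lessThan_Suc)
    have m': "m (?G x) = p - (?r + 1) mod p"
      using x p(1) by (simp add: m_def ij block_cycle_def)
    show ?thesis
    proof (cases "?r + 1 = p")
      case True
      \<comment> \<open>At the end of a block the next point starts a new round, so its u is a full
        orbit sum and vanishes modulo p.\<close>
      then have "m x = 1" "m (?G x) = p" using m' by (simp_all add: m_def ij)
      then have "u x = f x" "u (?G x) = (\<Sum>t<p. f (map_prod (?g ^^ t) (?g ^^ t) (?G x)))"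
        by (simp_all add: u_def ij)
      then show ?thesis using orbit[of "?G x"] cong_diff[OF cong_refl[of "f x"], of "u (?G x)" 0 "int p"]
        by (simp add: cong_sym_eq)
    next
      case False
      then have "(?r + 1) mod p = ?r + 1" using r by simp
      then have "m (?G x) = p - (?r + 1)" using m' by simp
      moreover have "m x = p - ?r" by (simp add: m_def ij)
      ultimately have "m x = Suc (m (?G x))" using r False by linarith
      then have "f x = u x - u (?G x)"
        unfolding u_def using shift[of "m (?G x)"] by simp
      then show ?thesis by simp
    qed
  qed
  have bij: "bij_betw ?G ?D ?D"
    using bij_betw_map_prod[OF permutes_imp_bij permutes_imp_bij] block_cycle_permutes[OF p] by blast
  have "[(\<Sum>x\<in>?D. w x * f x) = (\<Sum>x\<in>?D. w x * u x - w (?G x) * u (?G x))] (mod int p)"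
  proof (rule cong_sum)
    fix x assume x: "x \<in> ?D"
    have "[w x * f x = w x * (u x - u (?G x))] (mod int p)"
      by (intro cong_mult cong_refl step x)
    also have "w x * (u x - u (?G x)) = w x * u x - w x * u (?G x)" by (simp add: algebra_simps)
    also have "[\<dots> = w x * u x - w (?G x) * u (?G x)] (mod int p)"
      by (intro cong_diff cong_mult cong_refl cong_sym[OF w[OF x]])
    finally show "[w x * f x = w x * u x - w (?G x) * u (?G x)] (mod int p)" .
  qed
  \<comment> \<open>The two parts differ by a reindexing along the permutation of the pairs.\<close>
  also have "(\<Sum>x\<in>?D. w x * u x - w (?G x) * u (?G x)) = 0"
    using sum.reindex_bij_betw[OF bij, of "\<lambda>x. w x * u x"] by (simp add: sum_subtractf)
  finally show ?thesis .
qed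

section \<open>Labelled pairs modulo reversal\<close>

definition flip_point :: "nat \<Rightarrow> (nat \<times> nat) \<times> int \<Rightarrow> (nat \<times> nat) \<times> int" where
  "flip_point p = (\<lambda>((i, j), e). ((j, i), (- e) mod int p))"

definition flip_classes :: "nat \<Rightarrow> nat \<Rightarrow> ((nat \<times> nat) \<times> int) set set" where
  "flip_classes k p = (\<lambda>t. {t, flip_point p t}) ` weight_points k p"

lemma flip_point_closed: "t \<in> weight_points k p \<Longrightarrow> flip_point p t \<in> weight_points k p"
  by (auto simp: weight_points_def flip_point_def)

lemma flip_point_flip_point: "t \<in> weight_points k p \<Longrightarrow> flip_point p (flip_point p t) = t"
  by (auto simp: weight_points_def flip_point_def mod_simps)

lemma flip_point_neq: "t \<in> weight_points k p \<Longrightarrow> flip_point p t \<noteq> t"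
  by (auto simp: weight_points_def flip_point_def)

lemma flip_class_eq:
  "t \<in> weight_points k p \<Longrightarrow> x \<in> {t, flip_point p t} \<Longrightarrow> {t, flip_point p t} = {x, flip_point p x}"
  using flip_point_flip_point[of t k p] by (simp add: insert_commute disj_commute) (metis insert_commute)

lemma flip_class_cases:
  assumes "c \<in> flip_classes k p"
  obtains t where "t \<in> weight_points k p" "c = {t, flip_point p t}"
  using assms unfolding flip_classes_def by blast

lemma finite_flip_classes: "finite (flip_classes k p)"
  by (simp add: flip_classes_def finite_weight_points)

text \<open>Reversal is an involution without fixed points, since the entries of a pair differ; so
  its classes split the points into twos.\<close>

lemma card_flip_classes: "card (flip_classes k p) = p * k * (k - 1) div 2"
proof -
  have U: "\<Union> (flip_classes k p) = weight_points k p"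
    using flip_point_closed by (auto simp: flip_classes_def)
  have "2 * card (flip_classes k p) = card (\<Union> (flip_classes k p))"
  proof (rule card_partition)
    fix c assume "c \<in> flip_classes k p"
    then obtain t where "t \<in> weight_points k p" "c = {t, flip_point p t}" by (rule flip_class_cases)
    then show "card c = 2" using flip_point_neq[of t k p] by simp
  next
    fix c c' assume "c \<in> flip_classes k p" "c' \<in> flip_classes k p" "c \<noteq> c'"
    then show "c \<inter> c' = {}"
      using flip_class_eq by (metis disjoint_iff flip_class_cases)
  qed (simp_all add: U finite_weight_points finite_flip_classes)
  then show ?thesis by (simp add: U card_weight_points)
qed

text \<open>Antisymmetric weights act compatibly with reversal, so that the action descends to the
  classes.\<close>

lemma act_flip_point:
  assumes "\<And>i j. [f (i, j) + f (j, i) = 0] (mod int p)"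
  shows "weight_act p (f, g) (flip_point p t) = flip_point p (weight_act p (f, g) t)"
proof -
  obtain i j e where t: "t = ((i, j), e)" by (cases t) auto
  have "[- e + f (j, i) = - (e + f (i, j))] (mod int p)"
    using assms[of i j] by (simp add: cong_iff_dvd_diff algebra_simps)
  then show ?thesis
    by (simp add: t weight_act_def flip_point_def cong_def mod_simps)
qed

theorem nonsplit_extension_alt_odd:
  assumes k3: "k \<ge> 3" and p1: "p > 1" and odd: "odd p" and dvd: "p dvd k"
  shows "\<exists>(H :: nat monoid) M \<phi>. group H \<and> finite (carrier H) \<and>
         elem_abelian_p_subgroup p M H \<and> M \<noteq> {\<one>\<^bsub>H\<^esub>} \<and> M \<lhd> H \<and>
         (H Mod M) \<cong> alt_group k \<and> nonsplit M H \<and>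
         faithful_perm_rep H (p * k * (k - 1) div 2) \<phi>"
proof -
  interpret weight_cocycle k p "boundary_cocycle k p"
    by (rule weight_cocycle_boundary[OF k3 p1])
  have p0: "p > 0" using p1 by simp
  let ?a = "block_cycle k p" and ?D = "{1..k} \<times> {1..k}"
  have perm: "?a permutes {1..k}" by (rule block_cycle_permutes[OF p0 dvd])
  have a: "?a \<in> carrier (alt_group k)"
    using perm block_cycle_even[OF odd dvd] by (simp add: alt_group_carrier)
  have ap: "?a [^]\<^bsub>alt_group k\<^esub> p = \<one>\<^bsub>alt_group k\<^esub>"
    by (simp add: pow_alt_group alt_group_one block_cycle_pow_order[OF p0 dvd])
  have pk: "p \<in> {1..k}" using dvd p0 k3 by (simp add: dvd_imp_le)
  \<comment> \<open>The point p ends the first block and is thus the preimage of 1.\<close>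
  have "?a p = 1" using pk p0 by (simp add: block_cycle_def)
  then have a1: "?a i = 1 \<longleftrightarrow> i = p" for i
    using permutes_inj[OF perm] by (metis injD)
  have no_lift: "h [^]\<^bsub>G\<^esub> p \<noteq> \<one>\<^bsub>G\<^esub>" if h: "h \<in> carrier G" "snd h = ?a" for h
  proof
    obtain f where hf: "h = (f, ?a)" using h(2) by (cases h) auto
    assume "h [^]\<^bsub>G\<^esub> p = \<one>\<^bsub>G\<^esub>"
    then have orbit: "[(\<Sum>t<p. f (map_prod (?a ^^ t) (?a ^^ t) x)) = 0] (mod int p)" for x
      unfolding hf cong_def by (simp only: pow_eq_oneD mod_0)
    have Z: "boundary_cocycle k p ?a f" using h hf by (simp add: carrier_iff)
    \<comment> \<open>S is evaluated in two ways: the divergence gives p - 1, while orbit sums and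
      antisymmetry will give 2 S = 0 modulo p.\<close>
    define S where "S = (\<Sum>i=1..k. \<Sum>j=1..k. int i * f (i, j))"
    have "[S = (\<Sum>i=1..k. int i * (of_bool (?a i = 1) - of_bool (i = 1)))] (mod int p)"
      unfolding S_def sum_distrib_left[symmetric]
      using Z unfolding boundary_cocycle_def by (intro cong_sum cong_mult cong_refl) blast
    also have "(\<Sum>i=1..k. int i * (of_bool (?a i = 1) - of_bool (i = 1))) =
        (\<Sum>i=1..k. (if i = p then int i else 0) - (if i = 1 then int i else 0))"
      by (intro sum.cong) (auto simp only: a1 of_bool_def, simp_all)
    also have "\<dots> = int p - 1"
      using pk by (simp add: sum_subtractf)
    finally have S: "[S = int p - 1] (mod int p)" .
    \<comment> \<open>The weight i - j is invariant modulo p because the cycle adds one to both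
      entries.\<close>
    have "[(\<Sum>x\<in>?D. (int (fst x) - int (snd x)) * f x) = 0] (mod int p)"
    proof (rule cong_sum_zero_of_orbit_sums[OF p0 dvd orbit])
      fix x :: "nat \<times> nat" assume "x \<in> ?D"
      then have "[int (?a (fst x)) - int (?a (snd x)) = (int (fst x) + 1) - (int (snd x) + 1)] (mod int p)"
        by (intro cong_diff block_cycle_cong[OF p0]) auto
      then show "[int (fst (map_prod ?a ?a x)) - int (snd (map_prod ?a ?a x)) = int (fst x) - int (snd x)] (mod int p)"
        by simp
    qed
    also have "(\<Sum>x\<in>?D. (int (fst x) - int (snd x)) * f x) =
        S - (\<Sum>i=1..k. \<Sum>j=1..k. int j * f (i, j))"
      unfolding S_def by (simp add: sum.cartesian_product' left_diff_distrib sum_subtractf)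
    also have "(\<Sum>i=1..k. \<Sum>j=1..k. int j * f (i, j)) = (\<Sum>j=1..k. \<Sum>i=1..k. int j * f (i, j))"
      by (rule sum.swap)
    finally have "[S - (\<Sum>i=1..k. \<Sum>j=1..k. int i * f (j, i)) = 0] (mod int p)" .
    moreover have "[(\<Sum>i=1..k. \<Sum>j=1..k. int i * f (i, j)) + (\<Sum>i=1..k. \<Sum>j=1..k. int i * f (j, i)) =
        (\<Sum>i=1..k. \<Sum>j=1..k. int i * 0)] (mod int p)"
      unfolding sum.distrib[symmetric] distrib_left[symmetric]
      using Z unfolding boundary_cocycle_def by (intro cong_sum cong_mult cong_refl) blast
    \<comment> \<open>The first congruence says that S equals its transposed sum, the second that
      the two are opposite; adding them leaves 2 S.\<close>
    ultimately have "[(S - (\<Sum>i=1..k. \<Sum>j=1..k. int i * f (j, i))) +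
        (S + (\<Sum>i=1..k. \<Sum>j=1..k. int i * f (j, i))) = 0 + (\<Sum>i=1..k. \<Sum>j=1..k. int i * 0)] (mod int p)"
      unfolding S_def by (rule cong_add)
    then have "int p dvd 2 * S" by (simp add: cong_0_iff)
    moreover have "coprime (int p) 2"
      using odd by simp
    ultimately have "int p dvd S" by (simp add: coprime_dvd_mult_right_iff)
    then have "int p dvd int p - 1" using S by (simp add: cong_dvd_iff)
    then have "int p dvd 1" by (simp add: dvd_diff_right_iff dvd_diff_left_iff)
    then show False using p1 by simp
  qed
  have flip: "weight_act p h (flip_point p t) = flip_point p (weight_act p h t)" if "h \<in> carrier G" for h t
    using that by (cases h) (auto simp: carrier_iff boundary_cocycle_def intro!: act_flip_point)
  have img: "weight_act p h ` {t, flip_point p t} = {weight_act p h t, flip_point p (weight_act p h t)}"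
    if "h \<in> carrier G" for h t
    using flip[OF that] by simp
  have class_act: "weight_act p h ` c \<in> flip_classes k p" if h: "h \<in> carrier G" and c: "c \<in> flip_classes k p" for h c
  proof -
    obtain t where t: "t \<in> weight_points k p" "c = {t, flip_point p t}" using c by (rule flip_class_cases)
    show ?thesis
      unfolding flip_classes_def t(2) img[OF h] by (rule imageI[OF act_closed[OF h t(1)]])
  qed
  have class_sub: "c \<subseteq> weight_points k p" if "c \<in> flip_classes k p" for c
    using that flip_point_closed by (auto simp: flip_classes_def)
  have class_one: "weight_act p \<one>\<^bsub>G\<^esub> ` c = c" if "c \<in> flip_classes k p" for c
  proof -
    have "weight_act p \<one>\<^bsub>G\<^esub> ` c = id ` c"
      by (intro image_cong refl) (use class_sub[OF that] act_one in fastforce)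
    then show ?thesis by simp
  qed
  have class_mult: "weight_act p (h \<otimes>\<^bsub>G\<^esub> h') ` c = weight_act p h ` (weight_act p h' ` c)"
    if "h \<in> carrier G" "h' \<in> carrier G" for h h' c
    unfolding image_image act_mult[OF that] ..
  have faithful: "h = \<one>\<^bsub>G\<^esub>"
    if h: "h \<in> carrier G" and fixed: "\<And>c. c \<in> flip_classes k p \<Longrightarrow> weight_act p h ` c = c" for h
  proof (rule act_faithful[OF h])
    have fixed': "{weight_act p h t, flip_point p (weight_act p h t)} = {t, flip_point p t}"
      if "t \<in> weight_points k p" for t
      using fixed[of "{t, flip_point p t}"] that img[OF h, of t] by (simp add: flip_classes_def)
    show "{(i, j), (j, i)} = {map_prod (snd h) (snd h) (i, j), map_prod (snd h) (snd h) (j, i)}"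
      if "(i, j) \<in> opairs k" for i j
    proof -
      have "((i, j), 0) \<in> weight_points k p" using that p0 by (simp add: weight_points_def)
      \<comment> \<open>Forgetting the labels turns a fixed class into a fixed unordered
        pair.\<close>
      from arg_cong[OF fixed'[OF this], of "(`) fst"] show ?thesis
        by (cases h) (simp add: weight_act_def flip_point_def)
    qed
    \<comment> \<open>Over the identity the pair x stays in place, and its reversal is a different
      pair; so the image is the point itself and not its flip.\<close>
    show "weight_act p h (x, e) = (x, e)" if "(x, e) \<in> weight_points k p" "snd h = id" for x e
      using fixed'[OF that(1)] that
      by (cases h; cases x) (auto simp: weight_act_def flip_point_def weight_points_def doubleton_eq_iff)
  qed
  have "\<exists>(H :: nat monoid) M \<phi>. group H \<and> finite (carrier H) \<and>
         elem_abelian_p_subgroup p M H \<and> M \<noteq> {\<one>\<^bsub>H\<^esub>} \<and> M \<lhd> H \<and>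
         (H Mod M) \<cong> alt_group k \<and> nonsplit M H \<and>
         faithful_perm_rep H (p * k * (k - 1) div 2) \<phi> \<and>
         ((\<forall>x\<in>flip_classes k p. \<forall>y\<in>flip_classes k p. \<exists>h\<in>carrier G. weight_act p h ` x = y) \<longrightarrow>
           transitive_perm_rep H (p * k * (k - 1) div 2) \<phi>)"
    using realize_extension[where \<alpha> = "\<lambda>h. (`) (weight_act p h)", OF group_hom_snd finite_carrier
        snd_surj kernel_comm kernel_exponent a ap no_lift finite_flip_classes card_flip_classes
        class_act class_one class_mult faithful] .
  then show ?thesis by (elim ex_forward conjE) (intro conjI; assumption)
qed

theorem theorem1p2:
  fixes k p :: nat
  assumes "k \<ge> 10" and "Factorial_Ring.prime p"
  shows
   "(odd p \<and> p dvd k \<longrightarrow>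
      (\<exists>(H :: nat monoid) M \<phi>. group H \<and> finite (carrier H) \<and>
         elem_abelian_p_subgroup p M H \<and> M \<noteq> {\<one>\<^bsub>H\<^esub>} \<and> M \<lhd> H \<and>
         (H Mod M) \<cong> alt_group k \<and> nonsplit M H \<and>
         faithful_perm_rep H (p * k * (k - 1) div 2) \<phi>))
    \<and>
    (\<exists>(H :: nat monoid) M \<phi>. group H \<and> finite (carrier H) \<and>
         elem_abelian_p_subgroup 2 M H \<and> M \<noteq> {\<one>\<^bsub>H\<^esub>} \<and> M \<lhd> H \<and>
         (H Mod M) \<cong> alt_group k \<and> nonsplit M H \<and>
         faithful_perm_rep H (2 * k * (k - 1)) \<phi> \<and>
         transitive_perm_rep H (2 * k * (k - 1)) \<phi>)"
proof (intro conjI impI)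
  have "k \<ge> 3" "p > 1" using assms(1) prime_gt_1_nat[OF assms(2)] by auto
  then show "odd p \<and> p dvd k \<Longrightarrow> \<exists>(H :: nat monoid) M \<phi>. group H \<and> finite (carrier H) \<and>
         elem_abelian_p_subgroup p M H \<and> M \<noteq> {\<one>\<^bsub>H\<^esub>} \<and> M \<lhd> H \<and>
         (H Mod M) \<cong> alt_group k \<and> nonsplit M H \<and>
         faithful_perm_rep H (p * k * (k - 1) div 2) \<phi>"
    by (intro nonsplit_extension_alt_odd) auto
qed (rule nonsplit_extension_alt_2, use assms in simp)

end
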